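(* For every graph $G$, $\operatorname{diam}(\mathcal{I}(G)) \leq 2\operatorname{tw}(G)$.
   Context: Graphs are finite and simple; $\operatorname{tw}(G)$ is the treewidth of $G$. In an orientation $\vec{G}$ of a graph $G$, the inversion of a set $X \subseteq V(G)$ consists in reversing all arcs with both endvertices in $X$. The inversion graph $\mathcal{I}(G)$ is the graph whose vertices are the labelled orientations of $G$, two orientations being adjacent if and only if the inversion of some $X\subseteq V(G)$ transforms one into the other; $\operatorname{diam}(\mathcal{I}(G))$ is its diameter. *)

theory Defs
  imports "Graph_Theory.Graph_Theory"
begin

text \<open>
  A finite simple graph is a \<^locale>\<open>pair_graph\<close>: a finite, loop-free, symmetric digraph without
  parallel arcs, in which the edge \<open>uv\<close> is represented by the two arcs \<open>(u, v)\<close> and \<open>(v, u)\<close>.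
  The null graph is allowed.
\<close>

section \<open>Treewidth\<close>

text \<open>
  The library predicates \<open>forest\<close> and \<open>tree\<close> do not describe undirected trees in this
  representation: an edge traversed back and forth counts as a \<open>cycle\<close> of length two.
  The cycles of the underlying undirected graph are exactly those of length at least three.
\<close>
definition undirected_tree :: "'t pair_pre_digraph \<Rightarrow> bool" where
  "undirected_tree T \<longleftrightarrow>
     pair_graph T \<and> connected (with_proj T) \<and>
     \<not> (\<exists>p. pre_digraph.cycle (with_proj T) p \<and> 3 \<le> length p)"

definition tree_decomposition ::
    "'a pair_pre_digraph \<Rightarrow> 't pair_pre_digraph \<Rightarrow> ('t \<Rightarrow> 'a set) \<Rightarrow> bool" where
  "tree_decomposition G T B \<longleftrightarrow>
     undirected_tree T \<and>
     (\<Union>t\<in>pverts T. B t) = pverts G \<and>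
     (\<forall>(u, v)\<in>parcs G. \<exists>t\<in>pverts T. u \<in> B t \<and> v \<in> B t) \<and>
     (\<forall>v\<in>pverts G. connected (with_proj T \<restriction> {t \<in> pverts T. v \<in> B t}))"

text \<open>
  The subtraction truncates only if all bags are empty, i.e. for decompositions of the null graph,
  whose treewidth is thus 0 here.
\<close>
definition decomposition_width :: "'t pair_pre_digraph \<Rightarrow> ('t \<Rightarrow> 'a set) \<Rightarrow> nat" where
  "decomposition_width T B = Max ((\<lambda>t. card (B t)) ` pverts T) - 1"

text \<open>
  Trees on natural numbers suffice, since every finite tree is isomorphic to one of these.
\<close>
definition treewidth :: "'a pair_pre_digraph \<Rightarrow> nat" where
  "treewidth G =
     Inf {decomposition_width T B | (T :: nat pair_pre_digraph) B. tree_decomposition G T B}"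

section \<open>Inversions of orientations\<close>

definition orientation :: "'a pair_pre_digraph \<Rightarrow> 'a pair_pre_digraph \<Rightarrow> bool" where
  "orientation G D \<longleftrightarrow>
     pverts D = pverts G \<and> parcs D \<subseteq> parcs G \<and>
     (\<forall>(u, v)\<in>parcs G. (u, v) \<in> parcs D \<longleftrightarrow> (v, u) \<notin> parcs D)"

definition inversion :: "'a set \<Rightarrow> 'a pair_pre_digraph \<Rightarrow> 'a pair_pre_digraph" where
  "inversion X D =
     \<lparr> pverts = pverts D,
       parcs = (\<lambda>(u, v). if u \<in> X \<and> v \<in> X then (v, u) else (u, v)) ` parcs D \<rparr>"

definition inversion_graph :: "'a pair_pre_digraph \<Rightarrow> 'a pair_pre_digraph pair_pre_digraph" where
  "inversion_graph G =
     \<lparr> pverts = {D. orientation G D},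
       parcs = {(D, D'). orientation G D \<and> orientation G D' \<and> D \<noteq> D' \<and>
                  (\<exists>X \<subseteq> pverts G. D' = inversion X D)} \<rparr>"

lemma inversion_invol: "inversion X (inversion X D) = D"
proof -
  let ?f = "\<lambda>e. if fst e \<in> X \<and> snd e \<in> X then (snd e, fst e) else e"
  have f: "(\<lambda>(u, v). if u \<in> X \<and> v \<in> X then (v, u) else (u, v)) = ?f"
    by (rule ext) (simp add: case_prod_beta)
  have "?f ` ?f ` A = A" for A :: "('a \<times> 'a) set"
  proof -
    have "?f (?f e) = e" for e :: "'a \<times> 'a" by (cases e) auto
    then show ?thesis by (simp only: image_image image_ident)
  qed
  then show ?thesis
    unfolding inversion_def f by (cases D) (simp only: pair_pre_digraph.simps)
qed

lemma pair_graph_inversion_graph: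
  assumes "pair_graph G"
  shows "pair_graph (inversion_graph G)"
proof -
  interpret G: pair_graph G by fact
  have fin: "finite {D. orientation G D}"
  proof (rule finite_subset)
    show "{D. orientation G D} \<subseteq> (\<lambda>A. \<lparr> pverts = pverts G, parcs = A \<rparr>) ` Pow (parcs G)"
    proof
      fix D assume "D \<in> {D. orientation G D}"
      then have "D = \<lparr> pverts = pverts G, parcs = parcs D \<rparr>" "parcs D \<in> Pow (parcs G)"
        by (simp_all add: orientation_def)
      then show "D \<in> (\<lambda>A. \<lparr> pverts = pverts G, parcs = A \<rparr>) ` Pow (parcs G)"
        by (rule image_eqI)
    qed
    show "finite ((\<lambda>A. \<lparr> pverts = pverts G, parcs = A \<rparr>) ` Pow (parcs G))"
      using G.pair_finite_arcs by simp
  qed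
  have fin': "finite (parcs (inversion_graph G))"
    by (rule finite_subset[OF _ finite_cartesian_product[OF fin fin]])
      (auto simp: inversion_graph_def)
  have sym: "sym (parcs (inversion_graph G))"
  proof (rule symI)
    fix D D' assume "(D, D') \<in> parcs (inversion_graph G)"
    then obtain X where X: "orientation G D" "orientation G D'" "D \<noteq> D'" "X \<subseteq> pverts G"
        and D': "D' = inversion X D"
      by (auto simp: inversion_graph_def)
    from D' have "D = inversion X D'" by (simp only: inversion_invol)
    with X have "orientation G D' \<and> orientation G D \<and> D' \<noteq> D \<and>
        (\<exists>X \<subseteq> pverts G. D = inversion X D')"
      by blast
    then show "(D', D) \<in> parcs (inversion_graph G)"
      by (simp only: inversion_graph_def pair_pre_digraph.simps mem_Collect_eq case_prod_conv simp_thms)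
  qed
  show ?thesis
  proof unfold_locales
    show "symmetric (with_proj (inversion_graph G))"
      using sym by (simp add: symmetric_def)
    show "finite (pverts (inversion_graph G))"
      using fin by (simp add: inversion_graph_def)
  qed (use fin' in \<open>auto simp: inversion_graph_def\<close>)
qed

section \<open>Diameter\<close>

text \<open>
  With unit weights \<^const>\<open>wf_digraph.\<mu>\<close> is the graph distance, which is \<open>\<infinity>\<close> between different
  components; so a finite bound on the diameter includes connectedness.
\<close>
definition diameter :: "'v pair_pre_digraph \<Rightarrow> ereal" where
  "diameter H = (SUP u\<in>pverts H. SUP v\<in>pverts H. wf_digraph.\<mu> (with_proj H) (\<lambda>_. 1) u v)"

end

theory Submission
  imports Defs
begin

text \<open>
  Inverting \<open>X\<^sub>0, \<dots>, X\<^bsub>t-1\<^esub>\<close> in turn reverses the edge \<open>uv\<close> iff \<open>f u\<close> and \<open>f v\<close> have scalar product \<open>1\<close>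
  over the field with two elements, where \<open>f v = {i. v \<in> X\<^sub>i}\<close> is read as a vector of length \<open>t\<close>. So one has
  to choose the vectors \<open>f v\<close> with prescribed scalar products along the edges. Let \<open>k\<close> be the
  treewidth and \<open>t = 2k\<close>. The vertices are treated along a tree decomposition, such that a new vertex
  has to respect a set \<open>C\<close> of at most \<open>k\<close> old vertices of its bag, and such that any at most \<open>k\<close> vectors
  in a common bag remain linearly independent. The prescribed products with \<open>C\<close> leave
  \<open>2\<^bsup>t-|C|\<^esup> \<ge> 2\<^bsup>k\<^esup>\<close> candidates, whereas independence excludes only the sums of fewer than \<open>k\<close> vectors
  from \<open>C\<close>, of which there are fewer than \<open>2\<^bsup>k\<^esup>\<close>.
\<close>

section \<open>Vectors with prescribed scalar products\<close>

lemma prod_one_plus: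
  fixes g :: "'b \<Rightarrow> 'c :: comm_semiring_1"
  assumes "finite N"
  shows "(\<Prod>u\<in>N. 1 + g u) = (\<Sum>S\<in>Pow N. prod g S)"
  using prod_add[OF assms, of g "\<lambda>_. 1"] by (simp add: add.commute)

text \<open>
  Sets of naturals stand for vectors over the field with two elements: the scalar product of
  \<open>A\<close> and \<open>B\<close> is the parity of \<open>card (A \<inter> B)\<close>, and the following is the sum of the vectors \<open>f u\<close>.
\<close>
definition parity_sum :: "('a \<Rightarrow> nat set) \<Rightarrow> 'a set \<Rightarrow> nat set" where
  "parity_sum f S = {i. odd (card {u\<in>S. i \<in> f u})}"

lemma prod_minus_one_if:
  assumes "finite A"
  shows "(\<Prod>i\<in>A. if P i then - 1 else 1) = (- 1 :: int) ^ card {i\<in>A. P i}"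
  using assms by (simp add: prod.If_cases Int_def)

text \<open>
  Proved by expanding the indicator function of the set on the left as a character sum.
\<close>
lemma card_parity_fibre:
  assumes "finite N"
    and indep: "\<And>S. S \<subseteq> N \<Longrightarrow> S \<noteq> {} \<Longrightarrow> parity_sum f S \<inter> {..<t} \<noteq> {}"
  shows "2 ^ card N * card {x\<in>Pow {..<t}. \<forall>u\<in>N. odd (card (x \<inter> f u)) = P u} = 2 ^ t"
proof -
  define F where "F = {x\<in>Pow {..<t}. \<forall>u\<in>N. odd (card (x \<inter> f u)) = P u}"
  define p :: "'a \<Rightarrow> int" where "p u = (if P u then - 1 else 1)" for u
  define c :: "nat set \<Rightarrow> 'a \<Rightarrow> int" where "c x u = (- 1) ^ card (x \<inter> f u)" for x u
  define a :: "'a set \<Rightarrow> nat \<Rightarrow> int" where "a S i = (- 1) ^ card {u\<in>S. i \<in> f u}" for S i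
  \<comment> \<open>A factor is 2 if \<open>x\<close> has the prescribed product with
    \<open>f u\<close>, and 0 otherwise.\<close>
  have fib: "(\<Prod>u\<in>N. 1 + p u * c x u) = (if x \<in> F then 2 ^ card N else 0)" if x: "x \<in> Pow {..<t}" for x
  proof (cases "x \<in> F")
    case True
    then have "(\<Prod>u\<in>N. 1 + p u * c x u) = (\<Prod>u\<in>N. 2)"
      by (intro prod.cong) (auto simp: F_def p_def c_def)
    with True show ?thesis by simp
  next
    case False
    then obtain u where "u \<in> N" "odd (card (x \<inter> f u)) \<noteq> P u" using x unfolding F_def by blast
    then have "\<exists>u\<in>N. 1 + p u * c x u = 0" by (intro bexI[of _ u]) (auto simp: p_def c_def)
    with False \<open>finite N\<close> show ?thesis by (simp add: prod_zero)
  qed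
  \<comment> \<open>\<open>a S i\<close> is -1 exactly for \<open>i\<close> in
    \<open>parity_sum f S\<close>, so a product of characters is the character of the sum of the
    vectors.\<close>
  have swap: "(\<Prod>u\<in>S. c x u) = (\<Prod>i\<in>x. a S i)" if "S \<in> Pow N" "x \<in> Pow {..<t}" for S x
  proof -
    have fin: "finite S" "finite x" using that \<open>finite N\<close> by (auto dest: finite_subset)
    have "(\<Prod>u\<in>S. c x u) = (\<Prod>u\<in>S. \<Prod>i\<in>x. if i \<in> f u then - 1 else 1)"
      using fin by (simp add: c_def prod_minus_one_if Int_def)
    also have "\<dots> = (\<Prod>i\<in>x. \<Prod>u\<in>S. if i \<in> f u then - 1 else 1)" by (rule prod.swap)
    also have "\<dots> = (\<Prod>i\<in>x. a S i)"
      using fin by (simp add: a_def prod_minus_one_if)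
    finally show ?thesis .
  qed
  \<comment> \<open>The sum factors over the coordinates as the product of all
    \<open>1 + a S i\<close>; independence makes one factor vanish unless \<open>S\<close> is
    empty.\<close>
  have orth: "(\<Sum>x\<in>Pow {..<t}. \<Prod>i\<in>x. a S i) = (if S = {} then 2 ^ t else 0)" if S: "S \<in> Pow N" for S
  proof (cases "S = {}")
    case False
    then obtain i where "i < t" "odd (card {u\<in>S. i \<in> f u})"
      using indep[of S] S by (auto simp: parity_sum_def)
    then have "\<exists>i\<in>{..<t}. 1 + a S i = 0" by (intro bexI[of _ i]) (auto simp: a_def)
    with False show ?thesis by (simp add: prod_one_plus[symmetric] prod_zero)
  qed (simp add: a_def card_Pow)
  have "int (2 ^ card N * card F) = (\<Sum>x\<in>Pow {..<t}. if x \<in> F then 2 ^ card N else 0)"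
  proof -
    have "Pow {..<t} \<inter> F = F" by (auto simp: F_def)
    then show ?thesis by (simp add: sum.If_cases Int_def[symmetric])
  qed
  also have "\<dots> = (\<Sum>x\<in>Pow {..<t}. \<Prod>u\<in>N. 1 + p u * c x u)" using fib by (intro sum.cong) auto
  also have "\<dots> = (\<Sum>x\<in>Pow {..<t}. \<Sum>S\<in>Pow N. (\<Prod>u\<in>S. p u) * (\<Prod>u\<in>S. c x u))"
    using \<open>finite N\<close> by (simp add: prod_one_plus prod.distrib)
  also have "\<dots> = (\<Sum>S\<in>Pow N. \<Sum>x\<in>Pow {..<t}. (\<Prod>u\<in>S. p u) * (\<Prod>u\<in>S. c x u))"
    by (rule sum.swap)
  also have "\<dots> = (\<Sum>S\<in>Pow N. (\<Prod>u\<in>S. p u) * (\<Sum>x\<in>Pow {..<t}. \<Prod>i\<in>x. a S i))"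
    using swap by (simp add: sum_distrib_left)
  also have "\<dots> = (\<Sum>S\<in>Pow N. if S = {} then 2 ^ t else 0)"
    using orth by (intro sum.cong) auto
  also have "\<dots> = 2 ^ t" using \<open>finite N\<close> by simp
  finally have "int (2 ^ card N * card F) = int (2 ^ t)" by simp
  then show ?thesis unfolding F_def by (simp only: of_nat_eq_iff)
qed

text \<open>The middle clause is linear independence of any at most \<open>k\<close> of the vectors.
  Products are prescribed for all pairs in \<open>C\<close>, edges or not, so that a bag is treated
  like a clique.\<close>

definition compatible_on :: "nat \<Rightarrow> ('a \<Rightarrow> 'a \<Rightarrow> bool) \<Rightarrow> ('a \<Rightarrow> nat set) \<Rightarrow> 'a set \<Rightarrow> bool" where
  "compatible_on k P f C \<longleftrightarrow>
     (\<forall>u\<in>C. f u \<subseteq> {..<2 * k}) \<and>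
     (\<forall>S\<subseteq>C. S \<noteq> {} \<and> card S \<le> k \<longrightarrow> parity_sum f S \<noteq> {}) \<and>
     (\<forall>u\<in>C. \<forall>v\<in>C. u \<noteq> v \<longrightarrow> odd (card (f u \<inter> f v)) = P u v)"

lemma compatible_on_mono:
  assumes "compatible_on k P f C" "C' \<subseteq> C"
  shows "compatible_on k P f C'"
proof -
  have "S \<subseteq> C" if "S \<subseteq> C'" for S using that assms(2) by (rule subset_trans)
  moreover have "u \<in> C" if "u \<in> C'" for u using that assms(2) by (rule rev_subsetD)
  ultimately show ?thesis using assms(1) unfolding compatible_on_def by simp
qed

lemma parity_sum_cong: "(\<And>u. u \<in> S \<Longrightarrow> f u = g u) \<Longrightarrow> parity_sum f S = parity_sum g S"
  unfolding parity_sum_def by (simp cong: conj_cong)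

lemma compatible_on_cong:
  assumes "compatible_on k P f C" "\<And>u. u \<in> C \<Longrightarrow> g u = f u"
  shows "compatible_on k P g C"
proof -
  have "parity_sum g S = parity_sum f S" if "S \<subseteq> C" for S
    using that assms(2) by (intro parity_sum_cong) auto
  then show ?thesis using assms unfolding compatible_on_def by simp
qed

section \<open>Adding vertices to a bag\<close>

lemma parity_sum_insert:
  assumes "finite S" "v \<notin> S"
  shows "parity_sum f (insert v S) = sym_diff (f v) (parity_sum f S)"
proof -
  have "{u \<in> insert v S. i \<in> f u} =
      (if i \<in> f v then insert v {u\<in>S. i \<in> f u} else {u\<in>S. i \<in> f u})" for i by auto
  then show ?thesis using assms by (auto simp: parity_sum_def)
qed

text \<open>The bound has to be strict to leave a candidate over. If \<open>card N = k\<close>, the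
  set \<open>N\<close> itself is missing; otherwise even all subsets are too few.\<close>

lemma card_small_subsets:
  assumes "finite N" "card N \<le> k"
  shows "card {S\<in>Pow N. card S < k} < 2 ^ k"
proof (cases "card N = k")
  case True
  then have "{S\<in>Pow N. card S < k} \<subset> Pow N" by auto
  then have "card {S\<in>Pow N. card S < k} < card (Pow N)" using assms by (intro psubset_card_mono) auto
  with True assms show ?thesis by (simp add: card_Pow)
next
  case False
  have "card {S\<in>Pow N. card S < k} \<le> card (Pow N)" using assms by (intro card_mono) auto
  also have "\<dots> < 2 ^ k" using assms False by (simp add: card_Pow)
  finally show ?thesis .
qed

lemma compatible_on_insert:
  assumes C: "compatible_on k P f C" and fin: "finite C" and card: "card C \<le> k" and v: "v \<notin> C"
    and P: "\<And>u. u \<in> C \<Longrightarrow> P v u = P u v"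
  obtains x where "compatible_on k P (f(v := x)) (insert v C)"
proof -
  define F where "F = {x\<in>Pow {..<2 * k}. \<forall>u\<in>C. odd (card (x \<inter> f u)) = P u v}"
  \<comment> \<open>The forbidden values: a set containing \<open>v\<close> sums to zero iff
    \<open>x\<close> equals the sum over its other elements, of which there are fewer than
    \<open>k\<close>.\<close>
  define Z where "Z = parity_sum f ` {S\<in>Pow C. card S < k}"
  \<comment> \<open>As \<open>card C \<le> k\<close>, the independence clause covers every nonempty
    subset of \<open>C\<close>.\<close>
  have "parity_sum f S \<inter> {..<2 * k} \<noteq> {}" if S: "S \<subseteq> C" "S \<noteq> {}" for S
  proof -
    have "card S \<le> k" using S fin card by (meson card_mono le_trans)
    then have "parity_sum f S \<noteq> {}" using C S by (simp add: compatible_on_def)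
    moreover have "parity_sum f S \<subseteq> {..<2 * k}"
    proof
      fix i assume "i \<in> parity_sum f S"
      then have "{u\<in>S. i \<in> f u} \<noteq> {}" unfolding parity_sum_def by (auto simp only: mem_Collect_eq card.empty even_zero)
      then show "i \<in> {..<2 * k}" using C S by (auto simp: compatible_on_def)
    qed
    ultimately show ?thesis by auto
  qed
  then have "2 ^ card C * card F = 2 ^ (2 * k)"
    unfolding F_def by (rule card_parity_fibre[OF fin])
  moreover have "(2 :: nat) ^ (2 * k) = 2 ^ card C * 2 ^ (2 * k - card C)"
    using card by (simp add: power_add[symmetric])
  ultimately have "card F = 2 ^ (2 * k - card C)" by simp
  moreover have "(2 :: nat) ^ k \<le> 2 ^ (2 * k - card C)" using card by (intro power_increasing) auto
  moreover have "card Z < 2 ^ k"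
  proof -
    have "card Z \<le> card {S\<in>Pow C. card S < k}" using fin by (simp add: Z_def card_image_le)
    also have "\<dots> < 2 ^ k" using fin card by (rule card_small_subsets)
    finally show ?thesis .
  qed
  moreover have "finite Z" using fin by (simp add: Z_def)
  ultimately have "\<not> F \<subseteq> Z" using card_mono[of Z F] by linarith
  then obtain x where x: "x \<in> F" "x \<notin> Z" by auto
  let ?g = "f(v := x)"
  have "compatible_on k P ?g (insert v C)"
    unfolding compatible_on_def
  proof (intro conjI ballI allI impI)
    fix u assume "u \<in> insert v C"
    then show "?g u \<subseteq> {..<2 * k}" using C x by (auto simp: compatible_on_def F_def)
  next
    fix u w assume "u \<in> insert v C" "w \<in> insert v C" "u \<noteq> w"
    then show "odd (card (?g u \<inter> ?g w)) = P u w"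
      using C x P v by (auto simp: compatible_on_def F_def Int_commute)
  next
    fix S assume S: "S \<subseteq> insert v C" "S \<noteq> {} \<and> card S \<le> k"
    show "parity_sum ?g S \<noteq> {}"
    proof (cases "v \<in> S")
      case False
      then have "parity_sum ?g S = parity_sum f S" by (intro parity_sum_cong) auto
      moreover have "S \<subseteq> C" using False S by blast
      ultimately show ?thesis using S C by (simp add: compatible_on_def)
    next
      case True
      define S' where "S' = S - {v}"
      have S': "S = insert v S'" "v \<notin> S'" "S' \<subseteq> C" using True S by (auto simp: S'_def)
      have "finite S'" using S'(3) fin by (rule finite_subset)
      then have "card S' < k" using S S' by simp
      then have "parity_sum f S' \<in> Z" using S' by (auto simp: Z_def)
      moreover have "parity_sum ?g S' = parity_sum f S'" using S' by (intro parity_sum_cong) auto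
      ultimately have "parity_sum ?g S' \<noteq> x" using x by auto
      then show ?thesis using parity_sum_insert[OF \<open>finite S'\<close> S'(2), of ?g] S'(1) by auto
    qed
  qed
  then show ?thesis by (rule that)
qed

text \<open>The bound \<open>Suc k\<close> is the bag size for width \<open>k\<close>: before each
  insertion at most \<open>k\<close> vertices are present, as \<open>compatible_on_insert\<close>
  demands.\<close>

lemma compatible_on_extend:
  assumes "finite M" "finite C" "M \<inter> C = {}" "card (C \<union> M) \<le> Suc k" "compatible_on k P f C"
    and P: "\<And>u v. P u v = P v u"
  shows "\<exists>g. (\<forall>u. u \<notin> M \<longrightarrow> g u = f u) \<and> compatible_on k P g (C \<union> M)"
  using assms(1-5)
proof (induction M)
  case (insert v M)
  have card: "card (C \<union> insert v M) = Suc (card (C \<union> M))" using insert by auto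
  then obtain g where g: "\<forall>u. u \<notin> M \<longrightarrow> g u = f u" "compatible_on k P g (C \<union> M)"
    using insert by auto
  obtain x where "compatible_on k P (g(v := x)) (insert v (C \<union> M))"
    by (rule compatible_on_insert[OF g(2), of v]) (use insert card P in auto)
  moreover have "insert v (C \<union> M) = C \<union> insert v M" by auto
  moreover have "\<forall>u. u \<notin> insert v M \<longrightarrow> (g(v := x)) u = f u" using g(1) by simp
  ultimately show ?case by (intro exI[of _ "g(v := x)"]) (simp only: simp_thms)
qed auto

section \<open>Traversing a tree decomposition\<close>

text \<open>The detour from \<open>b\<close> to \<open>a\<close>, shortened to a path, is closed by
  the arc \<open>(a, b)\<close>.\<close>

lemma undirected_cycle_if_bypass:
  assumes "pair_graph T" "(a, b) \<in> parcs T" "(b, a) \<in> (parcs T - {(b, a)})\<^sup>*"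
  shows "\<exists>p. pre_digraph.cycle (with_proj T) p \<and> 3 \<le> length p"
proof -
  interpret pair_graph T by fact
  have "a \<noteq> b" using assms(2) no_loops' by blast
  define R where "R = parcs T - {(b, a)}"
  have "\<exists>p. awalk b p a \<and> set p \<subseteq> R"
    using assms(3) unfolding R_def[symmetric]
  proof induction
    case base
    have "awalk b [] b" using assms(2) by (simp add: awalk_Nil_iff in_arcsD2)
    then show ?case by (intro exI[of _ "[]"]) simp
  next
    case (step y z)
    then obtain p where p: "awalk b p y" "set p \<subseteq> R" by blast
    have "(y, z) \<in> parcs T" using step.hyps by (simp add: R_def)
    then have "awalk y [(y, z)] z" using arc_implies_awalk[of "(y, z)"] by simp
    then have "awalk b (p @ [(y, z)]) z" using p awalk_appendI by blast
    with p step.hyps show ?case by (intro exI[of _ "p @ [(y, z)]"]) auto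
  qed
  then obtain p where p: "awalk b p a" "set p \<subseteq> parcs T - {(b, a)}" by (auto simp: R_def)
  define q where "q = awalk_to_apath p"
  have q: "apath b q a" using p(1) by (simp add: q_def apath_awalk_to_apath)
  have "set q \<subseteq> parcs T - {(b, a)}"
    using awalk_to_apath_subset[OF p(1)] p(2) by (auto simp: q_def)
  moreover have qw: "awalk b q a" "distinct (pawalk_verts b q)" using q by (auto simp: apath_def)
  \<comment> \<open>Length 0 would force \<open>a = b\<close>, and length 1 the removed arc
    \<open>(b, a)\<close>.\<close>
  ultimately have len: "2 \<le> length q"
    using \<open>a \<noteq> b\<close> by (cases q; cases "tl q") (auto simp: awalk_Cons_iff awalk_Nil_iff)
  have ab: "awalk a [(a, b)] b" using assms(2) arc_implies_awalk[of "(a, b)"] by simp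
  have w: "awalk b (q @ [(a, b)]) b" using qw(1) ab awalk_appendI by blast
  have "pcas b q a" "pcas b (q @ [(a, b)]) b" using qw(1) w by (auto simp: awalk_def)
  \<comment> \<open>The tail of the second list is a rotation of the first, hence distinct.\<close>
  then have "pawalk_verts b q = b # map snd q" "pawalk_verts b (q @ [(a, b)]) = b # map snd q @ [b]"
    using len awalk_verts_conv'[of b q a] awalk_verts_conv'[of b "q @ [(a, b)]" b]
    by (cases q; auto)+
  then have "cycle (q @ [(a, b)])" using qw(2) w unfolding cycle_def by (intro exI[of _ b]) simp
  with len show ?thesis by (intro exI[of _ "q @ [(a, b)]"]) simp
qed

section \<open>Reachability in trees and subtrees\<close>

lemma connected_imp_rtrancl:
  assumes "connected H" "sym (arcs_ends H)" "x \<in> verts H" "y \<in> verts H"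
  shows "(x, y) \<in> (arcs_ends H)\<^sup>*"
proof -
  have "(arcs_ends H)\<^sup>s = arcs_ends H" using assms(2) by (auto simp: symcl_def sym_def)
  then have "(x, y) \<in> rtrancl_on (verts H) (arcs_ends H)" using assms by (simp add: connected_conv)
  then show ?thesis by (rule rtrancl_on_rtranclI)
qed

lemma arcs_ends_restrict: "arcs_ends (with_proj T \<restriction> S) = parcs T \<inter> S \<times> S"
  by (force simp: arcs_ends_conv)

lemma pair_graph_sym: "pair_graph T \<Longrightarrow> sym (parcs T)"
proof -
  assume "pair_graph T"
  then interpret pair_graph T .
  show ?thesis using sym_arcs by (simp add: symmetric_def)
qed

text \<open>The last clause is the form in which acyclicity is applied: every edge is a
  bridge.\<close>

lemma undirected_treeD:
  assumes "undirected_tree T"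
  shows "pair_graph T" "pverts T \<noteq> {}"
    and "\<And>x y. x \<in> pverts T \<Longrightarrow> y \<in> pverts T \<Longrightarrow> (x, y) \<in> (parcs T)\<^sup>*"
    and "\<And>a b. (a, b) \<in> parcs T \<Longrightarrow> (b, a) \<notin> (parcs T - {(b, a)})\<^sup>*"
proof -
  show pg: "pair_graph T" using assms by (simp add: undirected_tree_def)
  show "pverts T \<noteq> {}" using assms by (simp add: undirected_tree_def connected_conv)
  show "(x, y) \<in> (parcs T)\<^sup>*" if "x \<in> pverts T" "y \<in> pverts T" for x y
    using connected_imp_rtrancl[of "with_proj T"] that assms pair_graph_sym[OF pg]
    by (simp add: undirected_tree_def)
  show "(b, a) \<notin> (parcs T - {(b, a)})\<^sup>*" if "(a, b) \<in> parcs T" for a b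
    using undirected_cycle_if_bypass[OF pg that] assms by (auto simp: undirected_tree_def)
qed

text \<open>If \<open>v\<close> were in \<open>B b\<close> and \<open>B c\<close> but not in
  \<open>B a\<close>, the nodes whose bags contain \<open>v\<close> would join \<open>b\<close> to
  \<open>c\<close> avoiding \<open>a\<close>, and \<open>W\<close> would join \<open>c\<close> to
  \<open>a\<close> avoiding \<open>b\<close>; so the edge \<open>ab\<close> would not be a
  bridge.\<close>

lemma bag_Int_subset_adjacent_bag:
  assumes td: "tree_decomposition G T B"
    and W: "\<And>x y. x \<in> W \<Longrightarrow> y \<in> W \<Longrightarrow> (x, y) \<in> (parcs T \<inter> W \<times> W)\<^sup>*" "W \<subseteq> pverts T"
    and ab: "a \<in> W" "b \<notin> W" "(a, b) \<in> parcs T" and c: "c \<in> W"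
  shows "B b \<inter> B c \<subseteq> B a"
proof (rule subsetI, rule ccontr)
  fix v assume v: "v \<in> B b \<inter> B c" "v \<notin> B a"
  have ut: "undirected_tree T" using td by (simp add: tree_decomposition_def)
  interpret pair_graph T using undirected_treeD(1)[OF ut] .
  define S where "S = {t \<in> pverts T. v \<in> B t}"
  have bc: "b \<in> S" "c \<in> S" "a \<notin> S" using v ab W(2) c by (auto simp: S_def in_arcsD2)
  then have "v \<in> pverts G" using td by (auto simp: tree_decomposition_def S_def)
  then have conn: "connected (with_proj T \<restriction> S)"
    using td by (auto simp: tree_decomposition_def S_def)
  have "sym (arcs_ends (with_proj T \<restriction> S))"
    using pair_graph_sym[OF undirected_treeD(1)[OF ut]] by (auto simp: arcs_ends_restrict sym_def)
  from connected_imp_rtrancl[OF conn this, of b c]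
  have "(b, c) \<in> (parcs T \<inter> S \<times> S)\<^sup>*" using bc by (simp add: arcs_ends_restrict)
  also have "(parcs T \<inter> S \<times> S)\<^sup>* \<subseteq> (parcs T - {(b, a)})\<^sup>*" using bc by (intro rtrancl_mono) auto
  finally have "(b, c) \<in> (parcs T - {(b, a)})\<^sup>*" .
  moreover have "(c, a) \<in> (parcs T - {(b, a)})\<^sup>*"
    using W(1)[OF c ab(1)] rtrancl_mono[of "parcs T \<inter> W \<times> W" "parcs T - {(b, a)}"] ab by auto
  ultimately have "(b, a) \<in> (parcs T - {(b, a)})\<^sup>*" by (rule rtrancl_trans)
  then show False using undirected_treeD(4)[OF ut ab(3)] by simp
qed

lemma rtrancl_leaves_set:
  assumes "(x, y) \<in> R\<^sup>*" "x \<in> W" "y \<notin> W"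
  obtains a b where "a \<in> W" "b \<notin> W" "(a, b) \<in> R"
  using assms by (induction arbitrary: thesis rule: rtrancl_induct) blast+

text \<open>
  The assignment is extended bag by bag: of the vertices of a bag added next to \<open>a\<close>, those already
  treated lie in \<open>B a\<close>.
\<close>
lemma compatible_assignment:
  assumes td: "tree_decomposition G T B" and fin: "finite (pverts G)"
    and k: "\<And>t. t \<in> pverts T \<Longrightarrow> card (B t) \<le> Suc k"
    and P: "\<And>u v. P u v = P v u"
  shows "\<exists>f. \<forall>t\<in>pverts T. compatible_on k P f (B t)"
proof -
  have ut: "undirected_tree T" using td by (simp add: tree_decomposition_def)
  interpret pair_graph T using undirected_treeD(1)[OF ut] .
  have finB: "finite (B t)" if "t \<in> pverts T" for t
    using td fin that by (intro finite_subset[OF _ fin]) (auto simp: tree_decomposition_def)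
  \<comment> \<open>A maximal treated set \<open>W\<close> is taken instead of an explicit order of
    the nodes. Its connectedness is kept for \<open>bag_Int_subset_adjacent_bag\<close>.\<close>
  define Q where "Q W \<longleftrightarrow> W \<subseteq> pverts T \<and> W \<noteq> {} \<and>
      (\<forall>x\<in>W. \<forall>y\<in>W. (x, y) \<in> (parcs T \<inter> W \<times> W)\<^sup>*) \<and>
      (\<exists>f. \<forall>t\<in>W. compatible_on k P f (B t))" for W
  obtain r where r: "r \<in> pverts T" using undirected_treeD(2)[OF ut] by auto
  obtain f where "compatible_on k P f (B r)"
    using compatible_on_extend[of "B r" "{}" k P "\<lambda>_. {}"] r k finB P
    by (auto simp: compatible_on_def)
  then have "Q {r}" using r by (auto simp: Q_def)
  moreover have "finite {W. Q W}"
    by (rule finite_subset[of _ "Pow (pverts T)"]) (auto simp: Q_def)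
  ultimately obtain W where W: "Q W" and max: "\<And>W'. Q W' \<Longrightarrow> W \<subseteq> W' \<Longrightarrow> W' = W"
    using finite_has_maximal[of "{W. Q W}"] by auto
  have conn: "(x, y) \<in> (parcs T \<inter> W \<times> W)\<^sup>*" if "x \<in> W" "y \<in> W" for x y
    using W that by (simp add: Q_def)
  from W obtain f where f: "\<forall>t\<in>W. compatible_on k P f (B t)" by (auto simp: Q_def)
  have WT: "W \<subseteq> pverts T" using W by (simp add: Q_def)
  have "W = pverts T"
  proof (rule ccontr)
    assume "W \<noteq> pverts T"
    then obtain x y where "x \<in> W" "y \<in> pverts T" "y \<notin> W" using W by (auto simp: Q_def)
    moreover from this have "(x, y) \<in> (parcs T)\<^sup>*" using undirected_treeD(3)[OF ut] WT by blast
    ultimately obtain a b where ab: "a \<in> W" "b \<notin> W" "(a, b) \<in> parcs T"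
      using rtrancl_leaves_set by metis
    have b: "b \<in> pverts T" using ab(3) by (rule in_arcsD2)
    have ba: "(b, a) \<in> parcs T"
      using ab(3) pair_graph_sym[OF undirected_treeD(1)[OF ut]] by (auto dest: symD)
    have Int: "B b \<inter> B c \<subseteq> B a" if "c \<in> W" for c
      using bag_Int_subset_adjacent_bag[OF td conn WT ab that] .
    have "compatible_on k P f (B b \<inter> B a)" using f ab(1) by (auto intro: compatible_on_mono)
    moreover have "B b \<inter> B a \<union> (B b - B a) = B b" by auto
    ultimately obtain g where g: "\<forall>u. u \<notin> B b - B a \<longrightarrow> g u = f u" "compatible_on k P g (B b)"
      using compatible_on_extend[of "B b - B a" "B b \<inter> B a" k P f] finB[OF b] k[OF b] P by auto
    \<comment> \<open>By \<open>Int\<close>, no treated bag meets \<open>B b - B a\<close>, the only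
      place where \<open>g\<close> may differ from \<open>f\<close>.\<close>
    have "compatible_on k P g (B t)" if "t \<in> W" for t
      by (rule compatible_on_cong[of k P f]) (use f g(1) Int that in auto)
    with g(2) have "\<forall>t\<in>insert b W. compatible_on k P g (B t)" by auto
    moreover have "(x, y) \<in> (parcs T \<inter> insert b W \<times> insert b W)\<^sup>*"
      if "x \<in> insert b W" "y \<in> insert b W" for x y
    proof -
      let ?R = "parcs T \<inter> insert b W \<times> insert b W"
      \<comment> \<open>Any two nodes are then joined through \<open>a\<close>.\<close>
      have "(z, a) \<in> ?R\<^sup>* \<and> (a, z) \<in> ?R\<^sup>*" if "z \<in> insert b W" for z
      proof (cases "z = b")
        case True
        then show ?thesis using ab ba by blast
      next
        case False
        then have "(z, a) \<in> (parcs T \<inter> W \<times> W)\<^sup>*" "(a, z) \<in> (parcs T \<inter> W \<times> W)\<^sup>*"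
          using conn ab(1) that by auto
        moreover have "(parcs T \<inter> W \<times> W)\<^sup>* \<subseteq> ?R\<^sup>*" by (intro rtrancl_mono) auto
        ultimately show ?thesis by auto
      qed
      with that show ?thesis by (meson rtrancl_trans)
    qed
    ultimately have "Q (insert b W)" using WT b unfolding Q_def by blast
    from max[OF this] ab(2) show False by auto
  qed
  with f show ?thesis by auto
qed

lemma tree_decomposition_attaining_treewidth:
  assumes "pair_graph G"
  obtains T :: "nat pair_pre_digraph" and B
  where "tree_decomposition G T B" "\<And>t. t \<in> pverts T \<Longrightarrow> card (B t) \<le> Suc (treewidth G)"
proof -
  interpret pair_graph G by fact
  let ?A = "{decomposition_width T B | (T :: nat pair_pre_digraph) B. tree_decomposition G T B}"
  \<comment> \<open>A single node whose bag is the whole vertex set shows that the infimum is over a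
    nonempty set, hence attained.\<close>
  let ?T = "\<lparr> pverts = {0 :: nat}, parcs = {} \<rparr>"
  have "pair_graph ?T" by unfold_locales (auto simp: symmetric_def)
  moreover have "\<not> pre_digraph.cycle (with_proj ?T) p" for p
    by (cases p) (auto simp: pre_digraph.cycle_def pre_digraph.awalk_def)
  moreover have "{t. t = 0 \<and> v \<in> pverts G} = {0 :: nat}" if "v \<in> pverts G" for v using that by auto
  ultimately have "tree_decomposition G ?T (\<lambda>_. pverts G)"
    unfolding tree_decomposition_def undirected_tree_def
    by (auto simp: connected_conv in_arcsD1 in_arcsD2 intro!: rtrancl_on_refl)
  then have "?A \<noteq> {}" by blast
  then have "treewidth G \<in> ?A" unfolding treewidth_def by (rule Inf_nat_def1)
  then obtain T B where TB: "tree_decomposition G (T :: nat pair_pre_digraph) B"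
    and w: "treewidth G = decomposition_width T B" by auto
  then interpret T: pair_graph T by (simp add: tree_decomposition_def undirected_tree_def)
  have "card (B t) \<le> Suc (treewidth G)" if "t \<in> pverts T" for t
  proof -
    have "card (B t) \<le> Max ((\<lambda>t. card (B t)) ` pverts T)" using that by (intro Max_ge) auto
    then show ?thesis using w by (simp add: decomposition_width_def)
  qed
  with TB show ?thesis by (rule that)
qed

section \<open>Sequences of inversions\<close>

lemma inversion_arcs_iff:
  "(u, v) \<in> parcs (inversion X D) \<longleftrightarrow> (if u \<in> X \<and> v \<in> X then (v, u) \<in> parcs D else (u, v) \<in> parcs D)"
  by (force simp: inversion_def image_iff split: if_splits)

lemma orientation_arcs_iff:
  assumes "sym (parcs G)" "orientation G D" "(u, v) \<in> parcs G"
  shows "(v, u) \<in> parcs D \<longleftrightarrow> (u, v) \<notin> parcs D"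
  using assms by (auto simp: orientation_def sym_def)

lemma orientation_inversion:
  assumes "sym (parcs G)" "orientation G D"
  shows "orientation G (inversion X D)"
proof -
  have D: "(u, v) \<in> parcs G" if "(u, v) \<in> parcs D" for u v
    using assms(2) that by (auto simp: orientation_def)
  show ?thesis
    unfolding orientation_def
  proof (intro conjI ballI subsetI)
    show "pverts (inversion X D) = pverts G" using assms by (simp add: inversion_def orientation_def)
  next
    fix e assume "e \<in> parcs (inversion X D)"
    then show "e \<in> parcs G"
      using D symD[OF assms(1)] by (cases e) (simp add: inversion_arcs_iff split: if_splits)
  next
    fix e assume "e \<in> parcs G"
    then show "case e of (u, v) \<Rightarrow> (u, v) \<in> parcs (inversion X D) \<longleftrightarrow> (v, u) \<notin> parcs (inversion X D)"
      using orientation_arcs_iff[OF assms] by (cases e) (simp add: inversion_arcs_iff)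
  qed
qed

fun iterated_inversion :: "(nat \<Rightarrow> 'a set) \<Rightarrow> nat \<Rightarrow> 'a pair_pre_digraph \<Rightarrow> 'a pair_pre_digraph" where
  "iterated_inversion X 0 D = D"
| "iterated_inversion X (Suc n) D = inversion (X n) (iterated_inversion X n D)"

lemma orientation_iterated_inversion:
  "sym (parcs G) \<Longrightarrow> orientation G D \<Longrightarrow> orientation G (iterated_inversion X n D)"
  by (induction n) (auto intro: orientation_inversion)

text \<open>Each set containing both endvertices flips the edge, so only the parity of their number
  matters.\<close>

lemma iterated_inversion_arcs_iff:
  assumes "sym (parcs G)" "orientation G D" "(u, v) \<in> parcs G"
  shows "(u, v) \<in> parcs (iterated_inversion X n D) \<longleftrightarrow>
    ((u, v) \<in> parcs D) \<noteq> odd (card {i. i < n \<and> u \<in> X i \<and> v \<in> X i})"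
proof (induction n)
  case (Suc n)
  have "{i. i < Suc n \<and> u \<in> X i \<and> v \<in> X i} =
      (if u \<in> X n \<and> v \<in> X n then insert n {i. i < n \<and> u \<in> X i \<and> v \<in> X i}
       else {i. i < n \<and> u \<in> X i \<and> v \<in> X i})"
    by (auto simp: less_Suc_eq)
  then show ?case
    using Suc orientation_arcs_iff[OF assms(1) orientation_iterated_inversion[OF assms(1,2)] assms(3)]
    by (auto simp: inversion_arcs_iff)
qed simp

lemma mu_iterated_inversion_le:
  assumes "pair_graph G" "orientation G D" "\<And>i. X i \<subseteq> pverts G"
  shows "wf_digraph.\<mu> (with_proj (inversion_graph G)) (\<lambda>_. 1) D (iterated_inversion X n D) \<le> ereal (real n)"
proof -
  note sym = pair_graph_sym[OF assms(1)]
  interpret I: pair_graph "inversion_graph G" using pair_graph_inversion_graph[OF assms(1)] .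
  have "\<exists>p. I.awalk D p (iterated_inversion X n D) \<and> length p \<le> n"
  proof (induction n)
    case 0
    then show ?case using assms(2) by (intro exI[of _ "[]"]) (simp add: I.awalk_Nil_iff, simp add: inversion_graph_def)
  next
    case (Suc n)
    then obtain p where p: "I.awalk D p (iterated_inversion X n D)" "length p \<le> n" by auto
    let ?E = "iterated_inversion X n D" and ?E' = "iterated_inversion X (Suc n) D"
    show ?case
    \<comment> \<open>An inversion that changes nothing is not an arc of the inversion graph and
      adds no step, so the walk may be shorter than \<open>n\<close>.\<close>
    proof (cases "?E = ?E'")
      case True
      have "I.awalk D p ?E'" by (rule subst[OF True]) (rule p(1))
      with p(2) show ?thesis by (intro exI[of _ p] conjI) simp_all
    next
      case False
      have "orientation G ?E" "orientation G ?E'"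
        using orientation_iterated_inversion[OF sym assms(2)] by blast+
      then have "(?E, ?E') \<in> parcs (inversion_graph G)"
        using False assms(3)[of n] unfolding inversion_graph_def by simp blast
      then have "I.awalk ?E [(?E, ?E')] ?E'" using I.arc_implies_awalk[of "(?E, ?E')"] by simp
      with p(1) have "I.awalk D (p @ [(?E, ?E')]) ?E'" using I.awalk_appendI by blast
      moreover have "length (p @ [(?E, ?E')]) \<le> Suc n" using p(2) by simp
      ultimately show ?thesis by blast
    qed
  qed
  then obtain p where p: "I.awalk D p (iterated_inversion X n D)" "length p \<le> n" by auto
  have "I.awalk_cost (\<lambda>_. 1) p = real (length p)" by (induction p) auto
  with I.min_cost_le_walk_cost[OF p(1), of "\<lambda>_. 1"] p(2) show ?thesis
    by (metis ereal_less_eq(3) of_nat_le_iff order_trans)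
qed

theorem theorem7p1:
  fixes G :: "'a pair_pre_digraph"
  assumes "pair_graph G"
  shows "diameter (inversion_graph G) \<le> ereal (2 * real (treewidth G))"
proof -
  interpret pair_graph G by fact
  define k where "k = treewidth G"
  note sym = pair_graph_sym[OF assms]
  have "wf_digraph.\<mu> (with_proj (inversion_graph G)) (\<lambda>_. 1) D D' \<le> ereal (2 * real k)"
    if D: "orientation G D" and D': "orientation G D'" for D D'
  proof -
    define P where "P u v \<longleftrightarrow> ((u, v) \<in> parcs D) \<noteq> ((u, v) \<in> parcs D')" for u v
    \<comment> \<open>Scalar products are symmetric, so the prescription must be. On edges
      \<open>P'\<close> agrees with \<open>P\<close>; on non-edges it is false and asks for
      orthogonality.\<close>
    define P' where "P' u v \<longleftrightarrow> P u v \<or> P v u" for u v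
    obtain T :: "nat pair_pre_digraph" and B where td: "tree_decomposition G T B"
      and card: "\<And>t. t \<in> pverts T \<Longrightarrow> card (B t) \<le> Suc k"
      unfolding k_def using tree_decomposition_attaining_treewidth[OF assms] by blast
    have "\<exists>f. \<forall>t\<in>pverts T. compatible_on k P' f (B t)"
      by (rule compatible_assignment[OF td pair_finite_verts card]) (auto simp: P'_def)
    then obtain f where f: "\<And>t. t \<in> pverts T \<Longrightarrow> compatible_on k P' f (B t)" by blast
    \<comment> \<open>The \<open>i\<close>-th inverted set collects the vertices whose vector has
      coordinate \<open>i\<close> equal to 1.\<close>
    define X where "X i = {v \<in> pverts G. i \<in> f v}" for i
    let ?E = "iterated_inversion X (2 * k) D"
    have E: "orientation G ?E" using orientation_iterated_inversion[OF sym D] .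
    have "(u, v) \<in> parcs ?E \<longleftrightarrow> (u, v) \<in> parcs D'" if uv: "(u, v) \<in> parcs G" for u v
    proof -
      \<comment> \<open>Each edge lies in some bag, where its product is the prescribed one.\<close>
      obtain t where t: "t \<in> pverts T" "u \<in> B t" "v \<in> B t"
        using td uv by (fastforce simp: tree_decomposition_def)
      have "u \<noteq> v" using uv no_loops' by blast
      have "{i. i < 2 * k \<and> u \<in> X i \<and> v \<in> X i} = f u \<inter> f v"
        using f[OF t(1)] t uv by (auto simp: X_def compatible_on_def in_arcsD1 in_arcsD2)
      moreover have "odd (card (f u \<inter> f v)) = P' u v"
        using f[OF t(1)] t \<open>u \<noteq> v\<close> by (auto simp: compatible_on_def)
      moreover have "P' u v = P u v"
        using orientation_arcs_iff[OF sym D uv] orientation_arcs_iff[OF sym D' uv]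
        by (auto simp: P'_def P_def)
      ultimately show ?thesis
        using iterated_inversion_arcs_iff[OF sym D uv, of X "2 * k"] by (auto simp: P_def)
    qed
    moreover have "parcs ?E \<subseteq> parcs G" "parcs D' \<subseteq> parcs G" "pverts ?E = pverts D'"
      using E D' by (auto simp: orientation_def)
    ultimately have "?E = D'" by (intro pair_pre_digraph.equality) auto
    with mu_iterated_inversion_le[OF assms D, of X "2 * k"] show ?thesis by (auto simp: X_def)
  qed
  then show ?thesis
    unfolding diameter_def k_def by (auto simp: inversion_graph_def intro!: SUP_least)
qed

end
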